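(* Let $m\in\mathbb{Z}_{1}$ and let $S\in\mathbf{B}(\ell^{2}(\mathbb{Z},\mathbb{C}))$ be an $m$-isometric bilateral weighted shift with weights $(\lambda_{j})_{j\in\mathbb{Z}}\subset\mathbb{C}\setminus\{0\}$. The following conditions are equivalent: (i) $S^{*}$ is $m$-isometric; (ii) $S$ is unitary.
   Context: $\mathbb{Z}_{1}$ is the set of integers $\ge 1$. For a bounded sequence $(\lambda_{j})_{j\in\mathbb{Z}}\subset\mathbb{C}$, the bilateral weighted shift with weights $(\lambda_{j})_{j\in\mathbb{Z}}$ is the bounded operator on $\ell^{2}(\mathbb{Z},\mathbb{C})$ given by $S(h_{j})_{j\in\mathbb{Z}}=(\lambda_{j}h_{j-1})_{j\in\mathbb{Z}}$. A bounded operator $T$ on a Hilbert space is $m$-isometric ($m\in\mathbb{Z}_{1}$) if $\sum_{k=0}^{m}\binom{m}{k}(-1)^{m-k}T^{*k}T^{k}=0$. *)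

theory Defs
  imports "HOL-Analysis.Analysis"
begin

section \<open>The complex Hilbert space of square-summable families\<close>

typedef 'i ell2 = "{h :: 'i \<Rightarrow> complex. (\<lambda>j. (cmod (h j))\<^sup>2) summable_on UNIV}"
  morphisms coord Abs_ell2
  by (rule exI[of _ "\<lambda>_. 0"]) simp

setup_lifting type_definition_ell2

lemma summable_coord: "(\<lambda>j. (cmod (coord x j))\<^sup>2) summable_on UNIV"
  using coord[of x] by simp

lemma ell2_eqI: "(\<And>j. coord x j = coord y j) \<Longrightarrow> x = y"
  by (simp add: coord_inject[symmetric] ext)

lemma square_summable_add:
  fixes f g :: "'i \<Rightarrow> complex"
  assumes "(\<lambda>j. (cmod (f j))\<^sup>2) summable_on UNIV" "(\<lambda>j. (cmod (g j))\<^sup>2) summable_on UNIV"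
  shows "(\<lambda>j. (cmod (f j + g j))\<^sup>2) summable_on UNIV"
proof (rule summable_on_comparison_test)
  show "(\<lambda>j. 2 * (cmod (f j))\<^sup>2 + 2 * (cmod (g j))\<^sup>2) summable_on UNIV"
    by (intro summable_on_add summable_on_cmult_right assms)
  fix j
  have "(cmod (f j + g j))\<^sup>2 \<le> (cmod (f j) + cmod (g j))\<^sup>2"
    by (simp add: norm_triangle_ineq power_mono)
  also have "\<dots> \<le> 2 * (cmod (f j))\<^sup>2 + 2 * (cmod (g j))\<^sup>2"
    using sum_squares_bound[of "cmod (f j)" "cmod (g j)"] by (simp add: power2_sum)
  finally show "(cmod (f j + g j))\<^sup>2 \<le> 2 * (cmod (f j))\<^sup>2 + 2 * (cmod (g j))\<^sup>2" .
qed auto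

lemma square_summable_scale:
  fixes f :: "'i \<Rightarrow> complex"
  assumes "(\<lambda>j. (cmod (f j))\<^sup>2) summable_on UNIV"
  shows "(\<lambda>j. (cmod (c * f j))\<^sup>2) summable_on UNIV"
  using summable_on_cmult_right[OF assms, of "(cmod c)\<^sup>2"] by (simp add: norm_mult power_mult_distrib)

lemma abs_summable_mult_cnj:
  fixes f g :: "'i \<Rightarrow> complex"
  assumes "(\<lambda>j. (cmod (f j))\<^sup>2) summable_on UNIV" "(\<lambda>j. (cmod (g j))\<^sup>2) summable_on UNIV"
  shows "(\<lambda>j. cmod (f j * cnj (g j))) summable_on UNIV"
proof (rule summable_on_comparison_test)
  show "(\<lambda>j. (cmod (f j))\<^sup>2 + (cmod (g j))\<^sup>2) summable_on UNIV"
    by (intro summable_on_add assms)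
  fix j
  show "cmod (f j * cnj (g j)) \<le> (cmod (f j))\<^sup>2 + (cmod (g j))\<^sup>2"
    using sum_squares_bound[of "cmod (f j)" "cmod (g j)"]
      mult_nonneg_nonneg[OF norm_ge_zero norm_ge_zero, of "f j" "g j"]
    unfolding norm_mult complex_mod_cnj by linarith
qed auto

instantiation ell2 :: (type) real_vector
begin

lift_definition zero_ell2 :: "'a ell2" is "\<lambda>_. 0"
  by simp

lift_definition plus_ell2 :: "'a ell2 \<Rightarrow> 'a ell2 \<Rightarrow> 'a ell2" is "\<lambda>f g j. f j + g j"
  by (rule square_summable_add)

lift_definition uminus_ell2 :: "'a ell2 \<Rightarrow> 'a ell2" is "\<lambda>f j. - f j"
  by simp

lift_definition minus_ell2 :: "'a ell2 \<Rightarrow> 'a ell2 \<Rightarrow> 'a ell2" is "\<lambda>f g j. f j - g j"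
proof -
  fix f g :: "'a \<Rightarrow> complex"
  assume "(\<lambda>j. (cmod (f j))\<^sup>2) summable_on UNIV" "(\<lambda>j. (cmod (g j))\<^sup>2) summable_on UNIV"
  then show "(\<lambda>j. (cmod (f j - g j))\<^sup>2) summable_on UNIV"
    using square_summable_add[of f "\<lambda>j. - g j"] by simp
qed

lift_definition scaleR_ell2 :: "real \<Rightarrow> 'a ell2 \<Rightarrow> 'a ell2" is "\<lambda>r f j. of_real r * f j"
  by (rule square_summable_scale)

instance
  by standard (transfer; simp add: fun_eq_iff algebra_simps)+

end

lift_definition scaleC :: "complex \<Rightarrow> 'i ell2 \<Rightarrow> 'i ell2" is "\<lambda>c f j. c * f j"
  by (rule square_summable_scale)

definition cinner :: "'i ell2 \<Rightarrow> 'i ell2 \<Rightarrow> complex" where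
  "cinner x y = (\<Sum>\<^sub>\<infinity>j. coord x j * cnj (coord y j))"

lemma summable_cinner: "(\<lambda>j. coord x j * cnj (coord y j)) summable_on UNIV"
  by (rule abs_summable_summable[OF abs_summable_mult_cnj[OF summable_coord summable_coord]])

lemma cinner_self: "cinner x x = of_real (\<Sum>\<^sub>\<infinity>j. (cmod (coord x j))\<^sup>2)"
proof -
  have "((\<lambda>j. of_real ((cmod (coord x j))\<^sup>2)) has_sum
      (of_real (\<Sum>\<^sub>\<infinity>j. (cmod (coord x j))\<^sup>2) :: complex)) UNIV"
    by (rule has_sum_of_real[OF has_sum_infsum[OF summable_coord]])
  moreover have "(\<lambda>j. coord x j * cnj (coord x j)) = (\<lambda>j. of_real ((cmod (coord x j))\<^sup>2))"
    by (intro ext complex_norm_square[symmetric])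
  ultimately show ?thesis
    unfolding cinner_def by (metis infsumI)
qed

lemma cinner_commute: "cinner y x = cnj (cinner x y)"
  unfolding cinner_def by (simp flip: infsum_cnj add: mult.commute)

lemma cinner_add_left: "cinner (x + y) z = cinner x z + cinner y z"
  unfolding cinner_def plus_ell2.rep_eq
  by (simp add: distrib_right infsum_add summable_cinner)

lemma cinner_scaleC_left: "cinner (scaleC c x) y = c * cinner x y"
  unfolding cinner_def scaleC.rep_eq by (simp add: mult.assoc infsum_cmult_right')

lemma scaleR_eq_scaleC: "scaleR r x = scaleC (of_real r) x"
  by transfer simp

instantiation ell2 :: (type) real_inner
begin

definition inner_ell2 :: "'a ell2 \<Rightarrow> 'a ell2 \<Rightarrow> real" where
  "inner_ell2 x y = Re (cinner x y)"

definition norm_ell2 :: "'a ell2 \<Rightarrow> real" where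
  "norm_ell2 x = sqrt (\<Sum>\<^sub>\<infinity>j. (cmod (coord x j))\<^sup>2)"

definition sgn_ell2 :: "'a ell2 \<Rightarrow> 'a ell2" where
  "sgn_ell2 x = scaleR (inverse (norm x)) x"

definition dist_ell2 :: "'a ell2 \<Rightarrow> 'a ell2 \<Rightarrow> real" where
  "dist_ell2 x y = norm (x - y)"

definition uniformity_ell2 :: "('a ell2 \<times> 'a ell2) filter" where
  "uniformity_ell2 = (INF e\<in>{0<..}. principal {(x, y). dist x y < e})"

definition open_ell2 :: "'a ell2 set \<Rightarrow> bool" where
  "open_ell2 U \<longleftrightarrow> (\<forall>x\<in>U. eventually (\<lambda>(x', y). x' = x \<longrightarrow> y \<in> U) uniformity)"

instance
proof
  fix x y z :: "'a ell2" and r :: real and U :: "'a ell2 set"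
  show "inner x y = inner y x"
    unfolding inner_ell2_def by (subst cinner_commute) simp
  show "inner (x + y) z = inner x z + inner y z"
    by (simp add: inner_ell2_def cinner_add_left)
  show "inner (scaleR r x) y = r * inner x y"
    by (simp add: inner_ell2_def scaleR_eq_scaleC cinner_scaleC_left)
  show "0 \<le> inner x x"
    by (simp add: inner_ell2_def cinner_self infsum_nonneg)
  show "inner x x = 0 \<longleftrightarrow> x = 0"
  proof
    assume "inner x x = 0"
    then have "(\<Sum>\<^sub>\<infinity>j. (cmod (coord x j))\<^sup>2) = 0"
      by (simp add: inner_ell2_def cinner_self)
    then have "(cmod (coord x j))\<^sup>2 = 0" for j
      using nonneg_infsum_le_0D[of "\<lambda>j. (cmod (coord x j))\<^sup>2" UNIV j] summable_coord[of x] by simp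
    then show "x = 0"
      by (intro ell2_eqI) (simp add: zero_ell2.rep_eq)
  next
    assume "x = 0"
    then show "inner x x = 0"
      by (simp add: inner_ell2_def cinner_self zero_ell2.rep_eq)
  qed
  show "norm x = sqrt (inner x x)"
    by (simp add: norm_ell2_def inner_ell2_def cinner_self)
qed (rule sgn_ell2_def dist_ell2_def uniformity_ell2_def open_ell2_def)+

end


section \<open>Bounded operators\<close>

definition bounded_operator :: "('i ell2 \<Rightarrow> 'i ell2) \<Rightarrow> bool" where
  "bounded_operator T \<longleftrightarrow> bounded_linear T \<and> (\<forall>c x. T (scaleC c x) = scaleC c (T x))"

text \<open>
  For a bounded operator the map \<open>A\<close> below exists by the Riesz representation theorem;
  it is unique because the inner product is nondegenerate.
\<close>

definition hadjoint :: "('i ell2 \<Rightarrow> 'i ell2) \<Rightarrow> 'i ell2 \<Rightarrow> 'i ell2" where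
  "hadjoint T = (THE A. \<forall>x y. cinner (T x) y = cinner x (A y))"

definition m_isometric :: "nat \<Rightarrow> ('i ell2 \<Rightarrow> 'i ell2) \<Rightarrow> bool" where
  "m_isometric m T \<longleftrightarrow> bounded_operator T \<and>
     (\<forall>x. (\<Sum>k=0..m. (real (m choose k) * (-1) ^ (m - k)) *\<^sub>R (hadjoint T ^^ k) ((T ^^ k) x)) = 0)"

definition unitary :: "('i ell2 \<Rightarrow> 'i ell2) \<Rightarrow> bool" where
  "unitary T \<longleftrightarrow> bounded_operator T \<and> hadjoint T \<circ> T = id \<and> T \<circ> hadjoint T = id"

definition bilateral_weighted_shift :: "(int \<Rightarrow> complex) \<Rightarrow> (int ell2 \<Rightarrow> int ell2) \<Rightarrow> bool" where
  "bilateral_weighted_shift w S \<longleftrightarrow> bounded (range w) \<and> bounded_operator S \<and>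
     (\<forall>h j. coord (S h) j = w j * coord h (j - 1))"

end

theory Submission
  imports Defs "HOL-Computational_Algebra.Polynomial"
begin

text \<open>
  On the orbit of a basis vector \<open>e\<^sub>a\<close> put \<open>g n = \<parallel>S\<^sup>n e\<^sub>a\<parallel>\<^sup>2\<close>, a product of squared moduli of
  weights.  Evaluating the defining identities of \<open>m\<close>-isometries on basis vectors shows that
  the \<open>m\<close>-th differences of \<open>g\<close> (for \<open>S\<close>) and of \<open>1/g\<close> (for \<open>S\<^sup>*\<close>) vanish.  By Newton's forward
  difference formula both are polynomials in \<open>n\<close>; as their product is \<open>1\<close>, they are constant,
  so all weights have modulus \<open>1\<close>.
\<close>

section \<open>Sequences with vanishing differences\<close>

definition fdiff :: "(nat \<Rightarrow> real) \<Rightarrow> nat \<Rightarrow> real" where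
  "fdiff f n = f (Suc n) - f n"

text \<open>Pascal's rule in summed form. It drives two inductions: with signed values as
  \<open>d\<close> it expands iterated differences, with iterated differences as \<open>d\<close> it
  gives Newton's formula.\<close>

lemma sum_choose_pascal:
  fixes d :: "nat \<Rightarrow> real"
  shows "(\<Sum>k\<le>n. real (n choose k) * (d k + d (Suc k))) = (\<Sum>k\<le>Suc n. real (Suc n choose k) * d k)"
proof -
  have "(\<Sum>k\<le>n. real (n choose k) * d k) = d 0 + (\<Sum>k\<le>n. real (n choose Suc k) * d (Suc k))"
    using sum.atMost_Suc_shift[of "\<lambda>k. real (n choose k) * d k" n] by (simp add: binomial_eq_0)
  moreover have "(\<Sum>k\<le>Suc n. real (Suc n choose k) * d k)
      = d 0 + (\<Sum>k\<le>n. real (Suc n choose Suc k) * d (Suc k))"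
    by (subst sum.atMost_Suc_shift) simp
  ultimately show ?thesis
    by (simp add: sum.distrib algebra_simps)
qed

text \<open>The sign exponent \<open>m + k\<close> has the parity of \<open>m - k\<close> for
  \<open>k \<le> m\<close> and avoids truncated subtraction in the induction.\<close>

lemma fdiff_funpow_eq_sum:
  "(fdiff ^^ m) f n = (\<Sum>k\<le>m. real (m choose k) * ((-1) ^ (m + k) * f (n + k)))"
proof (induction m arbitrary: n)
  case (Suc m)
  define d where "d k = (-1) ^ (Suc m + k) * f (n + k)" for k
  have "(fdiff ^^ Suc m) f n
      = (\<Sum>k\<le>m. real (m choose k) * ((-1) ^ (m + k) * f (Suc n + k)))
        - (\<Sum>k\<le>m. real (m choose k) * ((-1) ^ (m + k) * f (n + k)))"
    by (simp add: fdiff_def Suc.IH)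
  also have "\<dots> = (\<Sum>k\<le>m. real (m choose k) * (d k + d (Suc k)))"
    by (simp add: d_def sum_subtractf[symmetric] algebra_simps)
  finally show ?case
    unfolding sum_choose_pascal by (simp add: d_def)
qed simp

lemma newton_forward: "f (a + n) = (\<Sum>k\<le>n. real (n choose k) * (fdiff ^^ k) f a)"
proof (induction n arbitrary: a)
  case (Suc n)
  have "(fdiff ^^ k) f (Suc a) = (fdiff ^^ k) f a + (fdiff ^^ Suc k) f a" for k
    by (simp add: fdiff_def)
  then have "f (a + Suc n) = (\<Sum>k\<le>n. real (n choose k) * ((fdiff ^^ k) f a + (fdiff ^^ Suc k) f a))"
    using Suc.IH[of "Suc a"] by simp
  then show ?case
    unfolding sum_choose_pascal[of n "\<lambda>k. (fdiff ^^ k) f a"] .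
qed simp

text \<open>The witness is the falling factorial divided by \<open>fact k\<close>. It also fits
  \<open>n < k\<close>, where the factor for \<open>i = n\<close> vanishes.\<close>

lemma choose_eq_poly: "\<exists>P. \<forall>n. real (n choose k) = poly P (real n)"
proof (intro exI allI)
  fix n
  show "real (n choose k) = poly (smult (1 / fact k) (\<Prod>i=0..<k. [:- real i, 1:])) (real n)"
    by (simp add: binomial_gbinomial gbinomial_prod_rev poly_prod)
qed

lemma poly_of_vanishing_fdiff:
  assumes "\<And>n. (fdiff ^^ m) f n = 0"
  shows "\<exists>P. \<forall>n. f n = poly P (real n)"
proof -
  obtain B where B: "\<And>k n. real (n choose k) = poly (B k) (real n)"
    using choose_eq_poly by metis
  have zero: "(fdiff ^^ k) f n = 0" if "m \<le> k" for k n
    using that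
  proof (induction k arbitrary: n rule: dec_induct)
    case (step k)
    then show ?case by (simp add: fdiff_def)
  qed (rule assms)
  have "f n = poly (\<Sum>k<m. smult ((fdiff ^^ k) f 0) (B k)) (real n)" for n
  proof -
    have "f n = (\<Sum>k\<le>n. real (n choose k) * (fdiff ^^ k) f 0)"
      using newton_forward[of f 0 n] by simp
    \<comment> \<open>The range becomes independent of \<open>n\<close>: terms with
      \<open>k > n\<close> have a zero binomial coefficient, terms with \<open>k \<ge> m\<close> a
      zero difference.\<close>
    also have "\<dots> = (\<Sum>k<m. real (n choose k) * (fdiff ^^ k) f 0)"
      by (rule sum.mono_neutral_cong) (auto simp: zero not_le not_less)
    finally show ?thesis
      by (simp add: poly_sum B mult.commute)
  qed
  then show ?thesis by blast
qed

lemma constant_if_fdiff_vanish_inverse: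
  assumes "\<And>n. g n \<noteq> 0"
    and "\<And>n. (fdiff ^^ m) g n = 0" and "\<And>n. (fdiff ^^ m) (\<lambda>n. inverse (g n)) n = 0"
  shows "g n = g 0"
proof -
  obtain P where P: "\<And>n. g n = poly P (real n)"
    using poly_of_vanishing_fdiff assms(2) by blast
  obtain Q where Q: "\<And>n. inverse (g n) = poly Q (real n)"
    using poly_of_vanishing_fdiff[OF assms(3)] by blast
  have "poly (P * Q - 1) (real n) = 0" for n
    using assms(1)[of n] by (simp flip: P Q)
  then have "range real \<subseteq> {x. poly (P * Q - 1) x = 0}" by auto
  moreover have "infinite (range real)"
    by (simp add: finite_image_iff inj_on_def)
  ultimately have "P * Q - 1 = 0"
    using finite_subset poly_roots_finite by blast
  \<comment> \<open>Agreement at all naturals has made \<open>P * Q = 1\<close> an identity of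
    polynomials, so \<open>P\<close> is a unit, hence constant.\<close>
  then have "P dvd 1" by (metis dvdI eq_iff_diff_eq_0)
  then obtain c where "P = [:c:]" by (auto simp: is_unit_poly_iff)
  then show ?thesis by (simp add: P)
qed

section \<open>Adjoint pairs\<close>

lemma cinner_add_right: "cinner x (y + z) = cinner x y + cinner x z"
  by (metis cinner_add_left cinner_commute complex_cnj_add)

lemma cinner_scaleC_right: "cinner x (scaleC c y) = cnj c * cinner x y"
  by (metis cinner_commute cinner_scaleC_left complex_cnj_mult)

lemma cinner_ext: "y = z" if "\<And>x. cinner x y = cinner x z"
  using that vector_eq_ldot[of y z] by (simp add: inner_ell2_def)

lemma norm_scaleC: "norm (scaleC c x) = cmod c * norm x"
  by (simp add: norm_ell2_def scaleC.rep_eq norm_mult power_mult_distrib infsum_cmult_right'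
      real_sqrt_mult)

lemma scaleC_scaleC: "scaleC c (scaleC d x) = scaleC (c * d) x"
  by (intro ell2_eqI) (simp add: scaleC.rep_eq)

text \<open>As a relation, adjointness can be checked for an explicit candidate before the definite
  description in \<open>hadjoint\<close> is evaluated, and it is symmetric.\<close>

definition adjoint_pair :: "('i ell2 \<Rightarrow> 'i ell2) \<Rightarrow> ('i ell2 \<Rightarrow> 'i ell2) \<Rightarrow> bool" where
  "adjoint_pair T A \<longleftrightarrow> (\<forall>x y. cinner (T x) y = cinner x (A y))"

lemma adjoint_pair_sym: "adjoint_pair T A \<Longrightarrow> adjoint_pair A T"
  unfolding adjoint_pair_def by (metis cinner_commute)

lemma hadjoint_eqI: "hadjoint T = A" if "adjoint_pair T A"
  unfolding hadjoint_def
proof (rule the_equality)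
  fix A' assume "\<forall>x y. cinner (T x) y = cinner x (A' y)"
  with that have "cinner x (A' y) = cinner x (A y)" for x y
    by (simp add: adjoint_pair_def)
  then show "A' = A" using cinner_ext by blast
qed (use that in \<open>simp add: adjoint_pair_def\<close>)

lemma adjoint_pair_funpow: "adjoint_pair (T ^^ k) (A ^^ k)" if "adjoint_pair T A"
  using that by (induction k) (auto simp: adjoint_pair_def funpow_swap1)

lemma bounded_operator_adjoint:
  assumes "bounded_operator T" "adjoint_pair T A"
  shows "bounded_operator A"
proof -
  have adj: "cinner x (A y) = cinner (T x) y" for x y
    using assms(2) by (simp add: adjoint_pair_def)
  have scale: "A (scaleC c x) = scaleC c (A x)" for c x
    by (rule cinner_ext) (simp add: adj cinner_scaleC_right)
  obtain K where K: "\<And>x. norm (T x) \<le> norm x * K"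
    using assms(1) bounded_linear.bounded unfolding bounded_operator_def by blast
  have "bounded_linear A"
  proof (rule bounded_linear_intro[where K = K])
    show "A (x + y) = A x + A y" for x y
      by (rule cinner_ext) (simp add: adj cinner_add_right)
    show "A (r *\<^sub>R x) = r *\<^sub>R A x" for r x
      by (simp add: scaleR_eq_scaleC scale)
    show "norm (A y) \<le> norm y * K" for y
    proof -
      have "norm (A y) * norm (A y) = inner (T (A y)) y"
        using power2_norm_eq_inner[of "A y"] by (simp add: inner_ell2_def adj power2_eq_square)
      also have "\<dots> \<le> norm (T (A y)) * norm y"
        by (rule norm_cauchy_schwarz)
      also have "\<dots> \<le> norm (A y) * (norm y * K)"
        using mult_right_mono[OF K norm_ge_zero, of "A y" y] by (simp add: mult_ac)
      \<comment> \<open>Cancelling \<open>norm (A y)\<close> requires it to be positive; otherwise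
        the bound follows from nonnegativity of the right-hand side.\<close>
      finally have "norm (A y) \<le> norm y * K \<or> norm (A y) = 0"
        by (metis mult_le_cancel_left_pos norm_ge_zero order_le_less)
      moreover have "0 \<le> norm y * K"
        using K[of y] norm_ge_zero order_trans by blast
      ultimately show ?thesis by auto
    qed
  qed
  then show ?thesis using scale by (simp add: bounded_operator_def)
qed

text \<open>Pairing the operator identity with \<open>x\<close> and moving \<open>A ^^ k\<close>
  across the inner product turns each term into a squared norm.\<close>

lemma m_isometric_norm_sum:
  assumes "m_isometric m T" "adjoint_pair T A"
  shows "(\<Sum>k\<le>m. real (m choose k) * ((-1) ^ (m + k) * (norm ((T ^^ k) x))\<^sup>2)) = 0"
proof -
  have norm_sq: "inner x ((A ^^ k) ((T ^^ k) x)) = (norm ((T ^^ k) x))\<^sup>2" for k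
    using adjoint_pair_funpow[OF assms(2), of k]
    by (simp add: adjoint_pair_def inner_ell2_def power2_norm_eq_inner)
  have sign: "(-1) ^ (m - k) = ((-1) ^ (m + k) :: real)" if "k \<le> m" for k
    using that by (simp add: minus_one_power_iff)
  have "0 = inner x (\<Sum>k=0..m. (real (m choose k) * (-1) ^ (m - k)) *\<^sub>R (A ^^ k) ((T ^^ k) x))"
    using assms by (simp add: m_isometric_def hadjoint_eqI)
  also have "\<dots> = (\<Sum>k=0..m. real (m choose k) * ((-1) ^ (m - k) * (norm ((T ^^ k) x))\<^sup>2))"
    by (simp add: inner_sum_right norm_sq mult.assoc)
  finally show ?thesis
    by (simp add: sign atLeast0AtMost)
qed

text \<open>Every \<open>(A ^^ k) \<circ> (T ^^ k)\<close> is the identity, so the defining sum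
  collapses to \<open>(1 - 1) ^ m\<close>, which is zero for positive \<open>m\<close>.\<close>

lemma m_isometric_if_left_inverse_adjoint:
  assumes "m \<ge> 1" "bounded_operator T" "adjoint_pair T A" "A \<circ> T = id"
  shows "m_isometric m T"
proof -
  have "(A ^^ k) ((T ^^ k) x) = x" for k x
  proof (induction k)
    case (Suc k)
    then show ?case
      using fun_cong[OF assms(4)] by (simp add: funpow_swap1[of A])
  qed simp
  moreover have "(\<Sum>k=0..m. real (m choose k) * (-1) ^ (m - k)) = 0"
    using binomial_ring[of 1 "-1 :: real" m] assms(1) by (simp add: atLeast0AtMost zero_power)
  ultimately show ?thesis
    using assms by (simp add: m_isometric_def hadjoint_eqI flip: scaleR_left.sum)
qed

section \<open>Bilateral weighted shifts\<close>

lift_definition basis_vec :: "'i \<Rightarrow> 'i ell2" is "\<lambda>i j. if j = i then 1 else 0"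
proof -
  fix i :: 'i
  have "(\<lambda>j. (cmod (if j = i then 1 else 0))\<^sup>2) summable_on UNIV
      \<longleftrightarrow> (\<lambda>_. 1 :: real) summable_on {i}"
    by (rule summable_on_cong_neutral) auto
  then show "(\<lambda>j. (cmod (if j = i then 1 else 0))\<^sup>2) summable_on UNIV"
    by simp
qed

lemma norm_basis_vec: "norm (basis_vec i) = 1"
proof -
  have "(\<Sum>\<^sub>\<infinity>j. (cmod (coord (basis_vec i) j))\<^sup>2) = (\<Sum>\<^sub>\<infinity>j\<in>{i}. 1)"
    by (rule infsum_cong_neutral) (auto simp: basis_vec.rep_eq)
  then show ?thesis by (simp add: norm_ell2_def)
qed

lemma bilateral_weighted_shift_adjoint:
  assumes "bilateral_weighted_shift w S"
  obtains A where "adjoint_pair S A"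
    and "\<And>h j. coord (A h) j = cnj (w (j + 1)) * coord h (j + 1)"
proof -
  have S: "coord (S h) j = w j * coord h (j - 1)" for h j
    using assms by (simp add: bilateral_weighted_shift_def)
  obtain B where B: "\<And>j. cmod (w j) \<le> B"
    using assms by (auto simp: bilateral_weighted_shift_def bounded_iff)
  have bij: "bij_betw (\<lambda>j::int. j + 1) UNIV UNIV"
    by (rule bij_betwI[where g = "\<lambda>j. j - 1"]) auto
  define A where "A h = Abs_ell2 (\<lambda>j. cnj (w (j + 1)) * coord h (j + 1))" for h
  have A: "coord (A h) j = cnj (w (j + 1)) * coord h (j + 1)" for h j
  proof -
    have "(\<lambda>j. (cmod (cnj (w (j + 1)) * coord h (j + 1)))\<^sup>2) summable_on UNIV"
    proof (rule summable_on_comparison_test)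
      have "(\<lambda>j. (cmod (coord h (j + 1)))\<^sup>2) summable_on UNIV"
        using summable_coord[of h]
        unfolding summable_on_reindex_bij_betw[OF bij, of "\<lambda>j. (cmod (coord h j))\<^sup>2"] .
      then show "(\<lambda>j. B\<^sup>2 * (cmod (coord h (j + 1)))\<^sup>2) summable_on UNIV"
        by (rule summable_on_cmult_right)
      show "(cmod (cnj (w (j + 1)) * coord h (j + 1)))\<^sup>2 \<le> B\<^sup>2 * (cmod (coord h (j + 1)))\<^sup>2" for j
        using B by (simp add: norm_mult power_mult_distrib mult_right_mono power_mono)
    qed auto
    then show ?thesis by (simp add: A_def Abs_ell2_inverse)
  qed
  have "cinner (S x) y = cinner x (A y)" for x y
  proof -
    \<comment> \<open>Shifting the summation index by one leaves \<open>coord x j\<close> bare and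
      moves the weight, conjugated, to the other argument.\<close>
    have "cinner (S x) y = (\<Sum>\<^sub>\<infinity>j. coord (S x) (j + 1) * cnj (coord y (j + 1)))"
      unfolding cinner_def by (rule infsum_reindex_bij_betw[OF bij, symmetric])
    then show ?thesis by (simp add: cinner_def S A mult_ac)
  qed
  then have "adjoint_pair S A" by (simp add: adjoint_pair_def)
  then show thesis using A by (rule that)
qed

lemma forward_shift_basis_vec:
  assumes "\<And>h j. coord (S h) j = w j * coord h (j - 1)" and "\<And>c x. S (scaleC c x) = scaleC c (S x)"
  shows "(S ^^ k) (basis_vec j) = scaleC (\<Prod>i<k. w (j + 1 + int i)) (basis_vec (j + int k))"
proof (induction k)
  case 0
  show ?case by (rule ell2_eqI) (simp add: scaleC.rep_eq)
next
  case (Suc k)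
  have "S (basis_vec i) = scaleC (w (i + 1)) (basis_vec (i + 1))" for i
    by (rule ell2_eqI) (auto simp: assms(1) scaleC.rep_eq basis_vec.rep_eq)
  then show ?case
    by (simp add: Suc assms(2) scaleC_scaleC algebra_simps)
qed

lemma backward_shift_basis_vec:
  assumes "\<And>h j. coord (A h) j = v (j + 1) * coord h (j + 1)" and "\<And>c x. A (scaleC c x) = scaleC c (A x)"
  shows "(A ^^ k) (basis_vec j) = scaleC (\<Prod>i<k. v (j - int i)) (basis_vec (j - int k))"
proof (induction k)
  case 0
  show ?case by (rule ell2_eqI) (simp add: scaleC.rep_eq)
next
  case (Suc k)
  \<comment> \<open>The weight at \<open>i\<close> links the basis vectors at \<open>i - 1\<close>
    and \<open>i\<close>: going down it carries the source index, going up the target index.\<close>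
  have "A (basis_vec i) = scaleC (v i) (basis_vec (i - 1))" for i
    by (rule ell2_eqI) (auto simp: assms(1) scaleC.rep_eq basis_vec.rep_eq)
  then show ?case
    by (simp add: Suc assms(2) scaleC_scaleC algebra_simps)
qed

lemma weight_modulus_one:
  assumes S: "bilateral_weighted_shift w S" and w: "\<And>j. w j \<noteq> 0"
    and "m_isometric m S" "m_isometric m A"
    and adj: "adjoint_pair S A"
    and A: "\<And>h j. coord (A h) j = cnj (w (j + 1)) * coord h (j + 1)"
  shows "cmod (w (a + 1)) = 1"
proof -
  \<comment> \<open>Starting the product at \<open>a + 1\<close> gives \<open>g 0 = 1\<close> and
    makes \<open>g 1\<close> the squared modulus in question.\<close>
  define g :: "nat \<Rightarrow> real" where "g n = (\<Prod>i<n. (cmod (w (a + 1 + int i)))\<^sup>2)" for n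
  have g: "g n \<noteq> 0" for n
    using w by (simp add: g_def)
  have forward: "(norm ((S ^^ k) (basis_vec (a + int n))))\<^sup>2 = g (n + k) / g n" for n k
  proof -
    have "g (n + k) = g n * (\<Prod>i<k. (cmod (w (a + int n + 1 + int i)))\<^sup>2)"
      by (induction k) (simp_all add: g_def algebra_simps)
    moreover have "(S ^^ k) (basis_vec (a + int n))
        = scaleC (\<Prod>i<k. w (a + int n + 1 + int i)) (basis_vec (a + int n + int k))"
      using S by (intro forward_shift_basis_vec) (auto simp: bilateral_weighted_shift_def bounded_operator_def)
    ultimately show ?thesis
      using g[of n] by (simp add: norm_scaleC norm_basis_vec prod_norm[symmetric] prod_power_distrib)
  qed
  \<comment> \<open>The adjoint descends from \<open>a + int (n + k)\<close> through the same
    weights that \<open>S\<close> meets on the way up, in reverse order and conjugated.\<close>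
  have backward: "(norm ((A ^^ k) (basis_vec (a + int (n + k)))))\<^sup>2 = g (n + k) / g n" for n k
  proof -
    have "(\<Prod>i<k. (cmod (w (a + int (n + k) - int i)))\<^sup>2)
        = (\<Prod>i<k. (cmod (w (a + int n + 1 + int i)))\<^sup>2)"
      by (subst prod.nat_diff_reindex[symmetric])
        (auto intro!: prod.cong simp: of_nat_diff algebra_simps)
    moreover have "g (n + k) = g n * (\<Prod>i<k. (cmod (w (a + int n + 1 + int i)))\<^sup>2)"
      by (induction k) (simp_all add: g_def algebra_simps)
    moreover have "(A ^^ k) (basis_vec (a + int (n + k)))
        = scaleC (\<Prod>i<k. cnj (w (a + int (n + k) - int i))) (basis_vec (a + int (n + k) - int k))"
      using \<open>m_isometric m A\<close> A
      by (intro backward_shift_basis_vec[where v = "\<lambda>j. cnj (w j)"])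
        (auto simp: m_isometric_def bounded_operator_def)
    ultimately show ?thesis
      using g[of n] by (simp add: norm_scaleC norm_basis_vec prod_norm[symmetric] prod_power_distrib)
  qed
  have "(fdiff ^^ m) g n = 0" for n
  proof -
    have "(fdiff ^^ m) g n
        = g n * (\<Sum>k\<le>m. real (m choose k) * ((-1) ^ (m + k) * (norm ((S ^^ k) (basis_vec (a + int n))))\<^sup>2))"
      using g[of n] by (simp add: fdiff_funpow_eq_sum forward sum_distrib_left)
    then show ?thesis
      using m_isometric_norm_sum[OF \<open>m_isometric m S\<close> adj] by simp
  qed
  moreover have "(fdiff ^^ m) (\<lambda>n. inverse (g n)) n = 0" for n
  proof -
    \<comment> \<open>With the top of the descent fixed, the numerator \<open>g (n + m)\<close> is
      the same in all terms and only reciprocals of \<open>g\<close> vary.\<close>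
    let ?e = "basis_vec (a + int (n + m))"
    have eq: "(norm ((A ^^ k) ?e))\<^sup>2 = g (n + m) * inverse (g (n + (m - k)))" if "k \<le> m" for k
      using that backward[of k "n + (m - k)"] by (simp add: divide_inverse)
    have "0 = (\<Sum>k\<le>m. real (m choose k) * ((-1) ^ (m + k) * (norm ((A ^^ k) ?e))\<^sup>2))"
      using m_isometric_norm_sum[OF \<open>m_isometric m A\<close> adjoint_pair_sym[OF adj]] by simp
    also have "\<dots> = (\<Sum>k\<le>m. real (m choose k) * ((-1) ^ (m + k) * (g (n + m) * inverse (g (n + (m - k))))))"
      by (intro sum.cong refl) (simp only: eq atMost_iff)
    \<comment> \<open>The reflection \<open>k\<close> to \<open>m - k\<close> restores increasing
      arguments; the sign \<open>(-1) ^ (2 * m - k)\<close> reduces to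
      \<open>(-1) ^ k\<close>.\<close>
    also have "\<dots> = (\<Sum>k\<le>m. real (m choose k) * ((-1) ^ k * (g (n + m) * inverse (g (n + k)))))"
      by (rule sum.reindex_bij_witness[where i = "\<lambda>k. m - k" and j = "\<lambda>k. m - k"])
        (auto simp: binomial_symmetric[symmetric] minus_one_power_iff)
    also have "\<dots> = (-1) ^ m * g (n + m) * (fdiff ^^ m) (\<lambda>n. inverse (g n)) n"
      by (simp add: fdiff_funpow_eq_sum sum_distrib_left power_add mult_ac)
    finally show ?thesis using g by simp
  qed
  ultimately have "g 1 = g 0"
    using constant_if_fdiff_vanish_inverse g by blast
  then show ?thesis by (simp add: g_def power2_eq_1_iff) (smt (verit) norm_ge_zero)
qed

theorem corollary4p8:
  fixes m :: nat
    and S :: "int ell2 \<Rightarrow> int ell2"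
    and w :: "int \<Rightarrow> complex"
  assumes "m \<ge> 1"
    and "bilateral_weighted_shift w S"
    and "\<And>j. w j \<noteq> 0"
    and "m_isometric m S"
  shows "m_isometric m (hadjoint S) \<longleftrightarrow> unitary S"
proof -
  have S: "bounded_operator S" "\<And>h j. coord (S h) j = w j * coord h (j - 1)"
    using assms(2) by (auto simp: bilateral_weighted_shift_def)
  obtain A where adj: "adjoint_pair S A"
    and A: "\<And>h j. coord (A h) j = cnj (w (j + 1)) * coord h (j + 1)"
    using bilateral_weighted_shift_adjoint[OF assms(2)] by blast
  show ?thesis
    unfolding hadjoint_eqI[OF adj]
  proof
    assume "m_isometric m A"
    then have "cmod (w j) = 1" for j
      using weight_modulus_one[OF assms(2-4) _ adj A, of "j - 1"] by simp
    then have "w j * cnj (w j) = 1" for j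
      by (metis complex_norm_square of_real_1 power_one)
    then have "A (S h) = h" "S (A h) = h" for h
      by (auto intro!: ell2_eqI simp: S A mult.commute mult.left_commute)
    then show "unitary S"
      using S by (simp add: unitary_def hadjoint_eqI[OF adj] fun_eq_iff)
  next
    assume "unitary S"
    \<comment> \<open>The left inverse criterion is applied to \<open>A\<close>, whose adjoint is
      \<open>S\<close>; this needs the other half of unitarity,
      \<open>S \<circ> A = id\<close>.\<close>
    then have "S \<circ> A = id"
      by (simp add: unitary_def hadjoint_eqI[OF adj])
    then show "m_isometric m A"
      using m_isometric_if_left_inverse_adjoint assms(1) bounded_operator_adjoint[OF S(1) adj]
        adjoint_pair_sym[OF adj] by blast
  qed
qed

end
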